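(* Suppose that Assumption A and Assumption B (with constants $\delta_t\ge 0$, $t=T_1,\dots,T-1$) stated in the context hold, that step 6 of the split-horizon DDP algorithm is solved to $\epsilon$-optimality, and that step 6 returns $(u_0,\dots,u_{T_1-1})$ and $(x_1,\dots,x_{T_1})$ when the algorithm converges. Let $G_0(x_0)$ be the optimal value of the exact problem (NLP), and let $G_{T_1}(x_{T_1})$ be the value of the second part of (NLP) as a function of the intermediate state $x_{T_1}$. Then $$G_0(x_0)\ \le\ \sum_{t=0}^{T_1-1}g_t(x_t,u_t)+G_{T_1}(x_{T_1})\ \le\ G_0(x_0)+\epsilon+\sum_{t=T_1}^{T-1}\delta_t .$$
   Context: Fix integers $0<T_1<T$, an initial state $x_0$, (general nonlinear) functions $f_t,g_t$ and sets $\mathcal Z_t$ for $t=0,\dots,T-1$, a function $g_T$, and vectors and matrices $c_t,d_t,A_t,B_t,E_t,F_t,h_t$ for $t=T_1,\dots,T-1$ and $c_T$, of compatible dimensions (states and inputs are finite-dimensional real vectors). **Exact problem (NLP).** $$G_0(x_0)=\min_{x_1,\dots,x_T,\,u_0,\dots,u_{T-1}}\ \sum_{t=0}^{T-1}g_t(x_t,u_t)+g_T(x_T)\quad\text{s.t. } x_{t+1}=f_t(x_t,u_t),\ (x_t,u_t)\in\mathcal Z_t,\ t=0,\dots,T-1,\ x_0\text{ given}.$$ The value of its second part ($t=T_1,\dots,T-1$), for given $x_{T_1}$, is $$G_{T_1}(x_{T_1})=\min_{x_{T_1+1},\dots,x_T,\,u_{T_1},\dots,u_{T-1}}\ \sum_{t=T_1}^{T-1}g_t(x_t,u_t)+g_T(x_T)\quad\text{s.t.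 } x_{t+1}=f_t(x_t,u_t),\ (x_t,u_t)\in\mathcal Z_t,\ t=T_1,\dots,T-1 .$$ **Second-stage linear problem (LP2)** for given $x_{T_1}$: $$\tilde G_{T_1}(x_{T_1})=\min_{\tilde x_{T_1+1},\dots,\tilde x_T,\ \tilde u_{T_1},\dots,\tilde u_{T-1}}\ \sum_{t=T_1}^{T-1}(c_t^\top\tilde x_t+d_t^\top\tilde u_t)+c_T^\top\tilde x_T$$ subject to $\tilde x_{t+1}=A_t\tilde x_t+B_t\tilde u_t$ and $E_t\tilde x_t+F_t\tilde u_t\le h_t$ for $t=T_1,\dots,T-1$, with $\tilde x_{T_1}=x_{T_1}$ given. **First-stage problem (NLP1).** Minimize $\sum_{t=0}^{T_1-1}g_t(x_t,u_t)+\tilde G_{T_1}(x_{T_1})$ over $x_1,\dots,x_{T_1},u_0,\dots,u_{T_1-1}$ subject to $x_{t+1}=f_t(x_t,u_t)$, $(x_t,u_t)\in\mathcal Z_t$ for $t=0,\dots,T_1-1$, $x_0$ given. Both (NLP) and the two-stage problem obtained by combining (NLP1) and (LP2) are assumed feasible. **Assumption A.** (LP2) is feasible for all $x_{T_1}$ that are feasible for (NLP1). **Assumption B.** For $t=T_1,\dots,T-1$ let $\tilde{\mathcal Z}_t$ be the set of $(\tilde x_t,\tilde u_t)$ with $E_t\tilde x_t+F_t\tilde u_t\le h_t$. For all $t=T_1,\dots,T-1$ there exists a map $M_t:\tilde{\mathcal Z}_t\to\mathcal Z_t$ such that (a) there exists $\delta_t\ge0$ such that for all $(\tilde x_t,\tilde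 u_t)\in\tilde{\mathcal Z}_t$, $c_t^\top\tilde x_t+d_t^\top\tilde u_t\le g_t(M_t(\tilde x_t,\tilde u_t))\le c_t^\top\tilde x_t+d_t^\top\tilde u_t+\delta_t$; and (b) $M_t$ is surjective, i.e. for all $(x_t,u_t)\in\mathcal Z_t$ there exists $(\tilde x_t,\tilde u_t)\in\tilde{\mathcal Z}_t$ with $M_t(\tilde x_t,\tilde u_t)=(x_t,u_t)$. (Because of the coupling $\tilde x_{T_1}=x_{T_1}$, at $t=T_1$ the map $M_{T_1}$ leaves $\tilde x_{T_1}$ unchanged and maps the input $\tilde u_{T_1}$ to a feasible input of (NLP).) **Split-horizon DDP algorithm.** Initialize $\mathcal H=\emptyset$, $UB=+\infty$, $LB=-\infty$. 1. Solve (NLP1) with $\tilde G_{T_1}(x_{T_1})$ replaced by $0$, obtaining a feasible solution $(u_0,\dots,u_{T_1-1}),(x_1,\dots,x_{T_1})$ of (NLP1). Then repeat steps 2–7: 2. Solve (LP2) (exactly) at the $x_{T_1}$ found in the previous step, obtaining $(\tilde u_{T_1},\dots,\tilde u_{T-1})$ and $(\tilde x_{T_1+1},\dots,\tilde x_T)$. Let $\lambda$ and $\nu$ be the dual variables corresponding to the equality constraint $\tilde x_{t+1}=A_t\tilde x_t+B_t\tilde u_t$ and the inequality constraint $E_t\tilde x_t+F_t\tilde u_t\le h_t$, respectively, at $t=T_1$. 3. Set $UB=\sum_{t=T_1}^{T-1}(c_t^\top\tilde x_t+d_t^\top\tilde u_t)+c_T^\top\tilde x_T$. 4. If $UB=LB$,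 stop (the algorithm has converged). 5. Let $a=A_{T_1}^\top\lambda+E_{T_1}^\top\nu+c_{T_1}$ and $b=-\nu^\top h_{T_1}$; replace $\mathcal H$ by $\mathcal H\cup\{(a,b)\}$. 6. Solve (NLP1) with $\tilde G_{T_1}(x_{T_1})$ replaced by $\underline G_{T_1}(x_{T_1})=\max_{(a,b)\in\mathcal H}(a^\top x_{T_1}+b)$, obtaining a feasible solution $(u_0,\dots,u_{T_1-1}),(x_1,\dots,x_{T_1})$ of (NLP1). 7. Set $LB=\underline G_{T_1}(x_{T_1})$. Step 6 is solved to $\epsilon$-optimality ($\epsilon\ge 0$) if the returned point is feasible and its objective value in the problem of step 6 exceeds the optimal value of that problem by at most $\epsilon$.
   Formalization: Added: for x_{T1} feasible for (NLP1), the maps M_t match feasible (LP2) and (NLP) tail trajectories in both directions, with g_T(x_T) equal to c_T^T x̃_T. Corrected: b also subtracts ν_t^T h_t for T_1<t<T. The literal claim is false without each. *)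

theory Defs
  imports "Jordan_Normal_Form.Matrix" "HOL-Library.Extended_Real"
begin

(* Vectors and matrices carry their dimensions as values, so state, input and constraint
   dimensions may differ from stage to stage.  Trajectories are functions on nat, of which
   only the values at the stages in question matter. *)

record problem =
  tsplit  :: nat                                        (* T_1 *)
  horizon :: nat                                        (* T *)
  xdim    :: "nat \<Rightarrow> nat"
  udim    :: "nat \<Rightarrow> nat"
  hdim    :: "nat \<Rightarrow> nat"
  xinit   :: "real vec"
  dyn     :: "nat \<Rightarrow> real vec \<Rightarrow> real vec \<Rightarrow> real vec"   (* f_t *)
  cost    :: "nat \<Rightarrow> real vec \<Rightarrow> real vec \<Rightarrow> real"       (* g_t, t < T *)
  fcost   :: "real vec \<Rightarrow> real"                         (* g_T *)
  Zset    :: "nat \<Rightarrow> (real vec \<times> real vec) set"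
  cvec    :: "nat \<Rightarrow> real vec"                          (* c_t, including c_T *)
  dvec    :: "nat \<Rightarrow> real vec"
  Amat    :: "nat \<Rightarrow> real mat"
  Bmat    :: "nat \<Rightarrow> real mat"
  Emat    :: "nat \<Rightarrow> real mat"
  Fmat    :: "nat \<Rightarrow> real mat"
  hvec    :: "nat \<Rightarrow> real vec"

definition well_formed :: "problem \<Rightarrow> bool" where
  "well_formed P \<longleftrightarrow>
     0 < tsplit P \<and> tsplit P < horizon P \<and>
     xinit P \<in> carrier_vec (xdim P 0) \<and>
     (\<forall>t < horizon P.
        Zset P t \<subseteq> carrier_vec (xdim P t) \<times> carrier_vec (udim P t) \<and>
        (\<forall>x \<in> carrier_vec (xdim P t). \<forall>u \<in> carrier_vec (udim P t).
           dyn P t x u \<in> carrier_vec (xdim P (Suc t)))) \<and>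
     (\<forall>t \<in> {tsplit P..<horizon P}.
        cvec P t \<in> carrier_vec (xdim P t) \<and>
        dvec P t \<in> carrier_vec (udim P t) \<and>
        Amat P t \<in> carrier_mat (xdim P (Suc t)) (xdim P t) \<and>
        Bmat P t \<in> carrier_mat (xdim P (Suc t)) (udim P t) \<and>
        Emat P t \<in> carrier_mat (hdim P t) (xdim P t) \<and>
        Fmat P t \<in> carrier_mat (hdim P t) (udim P t) \<and>
        hvec P t \<in> carrier_vec (hdim P t)) \<and>
     cvec P (horizon P) \<in> carrier_vec (xdim P (horizon P))"


section \<open>The exact problem\<close>

definition follows :: "problem \<Rightarrow> nat set \<Rightarrow> (nat \<Rightarrow> real vec) \<Rightarrow> (nat \<Rightarrow> real vec) \<Rightarrow> bool" where
  "follows P S x u \<longleftrightarrow>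
     (\<forall>t \<in> S. x (Suc t) = dyn P t (x t) (u t) \<and> (x t, u t) \<in> Zset P t)"

definition nlp_feasible :: "problem \<Rightarrow> (nat \<Rightarrow> real vec) \<Rightarrow> (nat \<Rightarrow> real vec) \<Rightarrow> bool" where
  "nlp_feasible P x u \<longleftrightarrow> x 0 = xinit P \<and> follows P {..<horizon P} x u"

definition tail_feasible ::
    "problem \<Rightarrow> real vec \<Rightarrow> (nat \<Rightarrow> real vec) \<Rightarrow> (nat \<Rightarrow> real vec) \<Rightarrow> bool" where
  "tail_feasible P y x u \<longleftrightarrow> x (tsplit P) = y \<and> follows P {tsplit P..<horizon P} x u"

(* Optimal values are infima in the extended reals: infinite if infeasible, and equal to the
   minimum whenever it is attained. *)

definition G0 :: "problem \<Rightarrow> ereal" where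
  "G0 P = (INF (x, u) \<in> {(x, u). nlp_feasible P x u}.
      ereal ((\<Sum>t<horizon P. cost P t (x t) (u t)) + fcost P (x (horizon P))))"

definition Gtail :: "problem \<Rightarrow> real vec \<Rightarrow> ereal" where
  "Gtail P y = (INF (x, u) \<in> {(x, u). tail_feasible P y x u}.
      ereal ((\<Sum>t = tsplit P..<horizon P. cost P t (x t) (u t)) + fcost P (x (horizon P))))"


section \<open>The second-stage linear problem\<close>

definition Ztilde :: "problem \<Rightarrow> nat \<Rightarrow> (real vec \<times> real vec) set" where
  "Ztilde P t = {(x, u). x \<in> carrier_vec (xdim P t) \<and> u \<in> carrier_vec (udim P t) \<and>
      Emat P t *\<^sub>v x + Fmat P t *\<^sub>v u \<le> hvec P t}"

definition lp2_feasible ::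
    "problem \<Rightarrow> real vec \<Rightarrow> (nat \<Rightarrow> real vec) \<Rightarrow> (nat \<Rightarrow> real vec) \<Rightarrow> bool" where
  "lp2_feasible P y x u \<longleftrightarrow> x (tsplit P) = y \<and>
     (\<forall>t \<in> {tsplit P..<horizon P}.
        x (Suc t) = Amat P t *\<^sub>v x t + Bmat P t *\<^sub>v u t \<and> (x t, u t) \<in> Ztilde P t)"

definition lp2_objective :: "problem \<Rightarrow> (nat \<Rightarrow> real vec) \<Rightarrow> (nat \<Rightarrow> real vec) \<Rightarrow> real" where
  "lp2_objective P x u =
     (\<Sum>t = tsplit P..<horizon P. cvec P t \<bullet> x t + dvec P t \<bullet> u t)
       + cvec P (horizon P) \<bullet> x (horizon P)"

definition lp2_optimal ::
    "problem \<Rightarrow> real vec \<Rightarrow> (nat \<Rightarrow> real vec) \<Rightarrow> (nat \<Rightarrow> real vec) \<Rightarrow> bool" where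
  "lp2_optimal P y x u \<longleftrightarrow> lp2_feasible P y x u \<and>
     (\<forall>x' u'. lp2_feasible P y x' u' \<longrightarrow> lp2_objective P x u \<le> lp2_objective P x' u')"

(* Dual variables at a primal solution, for the Lagrangian
     objective + sum_t lambda_t . (A_t x_t + B_t u_t - x_(t+1)) + sum_t nu_t . (E_t x_t + F_t u_t - h_t):
   nu >= 0, complementary slackness, and stationarity in u_t, in x_(t+1) for t + 1 < T, and in x_T.
   There is no stationarity in x_(T_1), which is given. *)

definition lp2_dual ::
    "problem \<Rightarrow> (nat \<Rightarrow> real vec) \<Rightarrow> (nat \<Rightarrow> real vec) \<Rightarrow> (nat \<Rightarrow> real vec) \<Rightarrow> (nat \<Rightarrow> real vec) \<Rightarrow> bool" where
  "lp2_dual P x u lam \<nu> \<longleftrightarrow>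
     (\<forall>t \<in> {tsplit P..<horizon P}.
        lam t \<in> carrier_vec (xdim P (Suc t)) \<and> \<nu> t \<in> carrier_vec (hdim P t) \<and>
        0\<^sub>v (hdim P t) \<le> \<nu> t \<and>
        \<nu> t \<bullet> (Emat P t *\<^sub>v x t + Fmat P t *\<^sub>v u t - hvec P t) = 0 \<and>
        dvec P t + transpose_mat (Bmat P t) *\<^sub>v lam t + transpose_mat (Fmat P t) *\<^sub>v \<nu> t
          = 0\<^sub>v (udim P t) \<and>
        lam t = (if Suc t < horizon P
               then cvec P (Suc t) + transpose_mat (Amat P (Suc t)) *\<^sub>v lam (Suc t)
                      + transpose_mat (Emat P (Suc t)) *\<^sub>v \<nu> (Suc t)
               else cvec P (horizon P)))"


section \<open>The first-stage problem\<close>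

definition nlp1_feasible :: "problem \<Rightarrow> (nat \<Rightarrow> real vec) \<Rightarrow> (nat \<Rightarrow> real vec) \<Rightarrow> bool" where
  "nlp1_feasible P x u \<longleftrightarrow> x 0 = xinit P \<and> follows P {..<tsplit P} x u"

definition nlp1_states :: "problem \<Rightarrow> real vec set" where
  "nlp1_states P = {x (tsplit P) | x u. nlp1_feasible P x u}"

definition first_cost :: "problem \<Rightarrow> (nat \<Rightarrow> real vec) \<Rightarrow> (nat \<Rightarrow> real vec) \<Rightarrow> real" where
  "first_cost P x u = (\<Sum>t<tsplit P. cost P t (x t) (u t))"

(* V is the function standing in for the second-stage value at x_(T_1). *)
definition nlp1_value :: "problem \<Rightarrow> (real vec \<Rightarrow> real) \<Rightarrow> ereal" where
  "nlp1_value P V = (INF (x, u) \<in> {(x, u). nlp1_feasible P x u}.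
      ereal (first_cost P x u + V (x (tsplit P))))"

definition nlp1_eps_optimal ::
    "problem \<Rightarrow> real \<Rightarrow> (real vec \<Rightarrow> real) \<Rightarrow> (nat \<Rightarrow> real vec) \<Rightarrow> (nat \<Rightarrow> real vec) \<Rightarrow> bool" where
  "nlp1_eps_optimal P \<epsilon> V x u \<longleftrightarrow> nlp1_feasible P x u \<and>
     ereal (first_cost P x u + V (x (tsplit P))) \<le> nlp1_value P V + ereal \<epsilon>"


section \<open>Assumptions\<close>

definition assumption_A :: "problem \<Rightarrow> bool" where
  "assumption_A P \<longleftrightarrow> (\<forall>y \<in> nlp1_states P. \<exists>x u. lp2_feasible P y x u)"

definition assumption_B ::
    "problem \<Rightarrow> (nat \<Rightarrow> real vec \<times> real vec \<Rightarrow> real vec \<times> real vec) \<Rightarrow> (nat \<Rightarrow> real) \<Rightarrow> bool" where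
  "assumption_B P M \<delta> \<longleftrightarrow>
     (\<forall>t \<in> {tsplit P..<horizon P}.
        (\<forall>z \<in> Ztilde P t. M t z \<in> Zset P t) \<and>
        0 \<le> \<delta> t \<and>
        (\<forall>(x, u) \<in> Ztilde P t.
           cvec P t \<bullet> x + dvec P t \<bullet> u \<le> case_prod (cost P t) (M t (x, u)) \<and>
           case_prod (cost P t) (M t (x, u)) \<le> cvec P t \<bullet> x + dvec P t \<bullet> u + \<delta> t) \<and>
        (\<forall>z \<in> Zset P t. \<exists>z' \<in> Ztilde P t. M t z' = z)) \<and>
     (\<forall>(x, u) \<in> Ztilde P (tsplit P). fst (M (tsplit P) (x, u)) = x)"

(* assumption_B compares single stages only: it relates neither the dynamics f_t to A_t, B_t nor
   the terminal cost g_T to c_T.  What applying the maps M_t along a whole trajectory requires in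
   addition is that they match feasible trajectories of the two tail problems, in both directions,
   with equal terminal costs. *)

definition matched ::
    "problem \<Rightarrow> (nat \<Rightarrow> real vec \<times> real vec \<Rightarrow> real vec \<times> real vec) \<Rightarrow>
     (nat \<Rightarrow> real vec) \<Rightarrow> (nat \<Rightarrow> real vec) \<Rightarrow> (nat \<Rightarrow> real vec) \<Rightarrow> (nat \<Rightarrow> real vec) \<Rightarrow> bool" where
  "matched P M x' u' x u \<longleftrightarrow>
     (\<forall>t \<in> {tsplit P..<horizon P}. M t (x' t, u' t) = (x t, u t)) \<and>
     fcost P (x (horizon P)) = cvec P (horizon P) \<bullet> x' (horizon P)"

definition dynamics_compatible ::
    "problem \<Rightarrow> (nat \<Rightarrow> real vec \<times> real vec \<Rightarrow> real vec \<times> real vec) \<Rightarrow> bool" where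
  "dynamics_compatible P M \<longleftrightarrow>
     (\<forall>y \<in> nlp1_states P.
        (\<forall>x' u'. lp2_feasible P y x' u' \<longrightarrow>
           (\<exists>x u. tail_feasible P y x u \<and> matched P M x' u' x u)) \<and>
        (\<forall>x u. tail_feasible P y x u \<longrightarrow>
           (\<exists>x' u'. lp2_feasible P y x' u' \<and> matched P M x' u' x u)))"


section \<open>The algorithm\<close>

definition cut_slope :: "problem \<Rightarrow> (nat \<Rightarrow> real vec) \<Rightarrow> (nat \<Rightarrow> real vec) \<Rightarrow> real vec" where
  "cut_slope P lam \<nu> = transpose_mat (Amat P (tsplit P)) *\<^sub>v lam (tsplit P)
     + transpose_mat (Emat P (tsplit P)) *\<^sub>v \<nu> (tsplit P) + cvec P (tsplit P)"

(* The constant term of the dual objective of the second-stage problem.  The stage T_1 term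
   - nu . h_(T_1) is all of it if T = T_1 + 1; otherwise, without the contributions of the later
   stages, the cut need not be a lower bound of the second-stage value. *)
definition cut_offset :: "problem \<Rightarrow> (nat \<Rightarrow> real vec) \<Rightarrow> real" where
  "cut_offset P \<nu> = - (\<nu> (tsplit P) \<bullet> hvec P (tsplit P))
     - (\<Sum>t \<in> {tsplit P<..<horizon P}. \<nu> t \<bullet> hvec P t)"

definition cut_max :: "(real vec \<times> real) set \<Rightarrow> real vec \<Rightarrow> real" where
  "cut_max H y = Max ((\<lambda>(a, b). a \<bullet> y + b) ` H)"

(* ddp P eps H UB LB x u: on some entry to step 2, the set of cuts is H, the bounds are UB and LB,
   and (x, u) is the latest solution of the first-stage problem.  Rule iteration is one pass
   through steps 2-7 that does not stop at step 4. *)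
inductive ddp ::
    "problem \<Rightarrow> real \<Rightarrow> (real vec \<times> real) set \<Rightarrow> ereal \<Rightarrow> ereal \<Rightarrow>
     (nat \<Rightarrow> real vec) \<Rightarrow> (nat \<Rightarrow> real vec) \<Rightarrow> bool" for P \<epsilon> where
  start: "nlp1_feasible P x u \<Longrightarrow> ddp P \<epsilon> {} \<infinity> (-\<infinity>) x u"
| iteration: "\<lbrakk>ddp P \<epsilon> H UB LB x u;
     lp2_optimal P (x (tsplit P)) x' u';
     lp2_dual P x' u' lam \<nu>;
     UB' = ereal (lp2_objective P x' u');
     UB' \<noteq> LB;
     H' = H \<union> {(cut_slope P lam \<nu>, cut_offset P \<nu>)};
     nlp1_eps_optimal P \<epsilon> (cut_max H') y v;
     LB' = ereal (cut_max H' (y (tsplit P)))\<rbrakk>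
   \<Longrightarrow> ddp P \<epsilon> H' UB' LB' y v"

(* (x, u) is the latest first-stage solution when the test in step 4 succeeds.  It then comes from
   step 6, because the test fails as long as LB is still minus infinity. *)
definition ddp_converges :: "problem \<Rightarrow> real \<Rightarrow> (nat \<Rightarrow> real vec) \<Rightarrow> (nat \<Rightarrow> real vec) \<Rightarrow> bool" where
  "ddp_converges P \<epsilon> x u \<longleftrightarrow>
     (\<exists>H UB LB x' u'. ddp P \<epsilon> H UB LB x u \<and> lp2_optimal P (x (tsplit P)) x' u' \<and>
        ereal (lp2_objective P x' u') = LB)"

end

theory Submission
  imports Defs
begin

text \<open>
  Two facts carry the proof.

  Weak duality: every cut is an affine minorant of the second-stage value.  Its multipliers
  satisfy \<open>\<nu> \<ge> 0\<close> and stationarity in all variables except the given intermediate state, and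
  the value of that state occurs in neither condition.  Hence multipliers computed at one trial
  state bound the second-stage value at every other one
  (\<open>dual_variables_give_lower_bound\<close>), and so does the maximum of the cuts.

  Matching of trajectories: the maps \<open>M\<^sub>t\<close> match feasible trajectories of the linear and of the
  exact tail, and the exact one of a matched pair costs no less than the linear one, and at most
  the sum of the \<open>\<delta>\<^sub>t\<close> more (\<open>matched_cost_bounds\<close>).

  When the algorithm stops, the maximum of the cuts at the current state equals the optimal
  value of the linear problem there.  Write \<open>V\<close> for this common value and \<open>C\<close> for the
  first-stage cost of the returned solution.  The exact tail matched with the optimal linear one
  shows that the optimal value of the exact tail is at most \<open>V + \<Sum> \<delta>\<^sub>t\<close>.  Conversely, any feasible trajectory of
  the exact problem costs at least as much as its first stage plus the cuts at its intermediate
  state, by weak duality for the linear tail that matches its second part; and by \<open>\<epsilon>\<close>-optimality that is at least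
  \<open>C + V - \<epsilon>\<close>.  Adding the two estimates gives the upper bound.  The lower bound holds because
  a first-stage solution followed by any exact tail is feasible for the exact problem.
\<close>

section \<open>Weak duality for the second-stage problem\<close>

lemma scalar_prod_left_mono:
  fixes w v v' :: "real vec"
  assumes "0\<^sub>v n \<le> w" "v \<le> v'" "v' \<in> carrier_vec n"
  shows "w \<bullet> v \<le> w \<bullet> v'"
  using assms unfolding scalar_prod_def less_eq_vec_def
  by (auto intro!: sum_mono mult_left_mono)

text \<open>
  One stage of the Lagrangian.  Stationarity in \<open>u\<close> removes the input from the left-hand side
  except through the constraint \<open>E x + F u \<le> h\<close>, whose price is nonnegative; what remains is
  the price of the current state, the same expression that stationarity in \<open>x\<close> equates with
  the multiplier of the preceding dynamics constraint.
\<close>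

lemma stage_lagrangian_bound:
  fixes A B E F :: "real mat" and x u c d h l w :: "real vec"
  assumes dims: "A \<in> carrier_mat k n" "B \<in> carrier_mat k m" "E \<in> carrier_mat q n"
      "F \<in> carrier_mat q m" "x \<in> carrier_vec n" "u \<in> carrier_vec m" "c \<in> carrier_vec n"
      "d \<in> carrier_vec m" "h \<in> carrier_vec q" "l \<in> carrier_vec k" "w \<in> carrier_vec q"
    and stationary: "d + transpose_mat B *\<^sub>v l + transpose_mat F *\<^sub>v w = 0\<^sub>v m"
    and nonneg: "0\<^sub>v q \<le> w"
    and constr: "E *\<^sub>v x + F *\<^sub>v u \<le> h"
  shows "(c + transpose_mat A *\<^sub>v l + transpose_mat E *\<^sub>v w) \<bullet> x - w \<bullet> h
           \<le> c \<bullet> x + d \<bullet> u + l \<bullet> (A *\<^sub>v x + B *\<^sub>v u)"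
proof -
  have input: "d \<bullet> u + l \<bullet> (B *\<^sub>v u) + w \<bullet> (F *\<^sub>v u) = 0"
  proof -
    have "(d + transpose_mat B *\<^sub>v l + transpose_mat F *\<^sub>v w) \<bullet> u = 0"
      using stationary dims by simp
    then show ?thesis
      using dims
      by (simp add: add_scalar_prod_distrib[where n = m] transpose_vec_mult_scalar
          mult_mat_vec_carrier transpose_carrier_mat)
  qed
  have state: "(c + transpose_mat A *\<^sub>v l + transpose_mat E *\<^sub>v w) \<bullet> x
      = c \<bullet> x + l \<bullet> (A *\<^sub>v x) + w \<bullet> (E *\<^sub>v x)"
    using dims
    by (simp add: add_scalar_prod_distrib[where n = n] transpose_vec_mult_scalar
        mult_mat_vec_carrier transpose_carrier_mat)
  have "w \<bullet> (E *\<^sub>v x) + w \<bullet> (F *\<^sub>v u) = w \<bullet> (E *\<^sub>v x + F *\<^sub>v u)"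
    using dims by (simp add: scalar_prod_add_distrib[where n = q] mult_mat_vec_carrier)
  also have "\<dots> \<le> w \<bullet> h"
    by (rule scalar_prod_left_mono[OF nonneg constr]) (use dims in simp)
  finally have "w \<bullet> (E *\<^sub>v x) + w \<bullet> (F *\<^sub>v u) \<le> w \<bullet> h" .
  moreover have "l \<bullet> (A *\<^sub>v x + B *\<^sub>v u) = l \<bullet> (A *\<^sub>v x) + l \<bullet> (B *\<^sub>v u)"
    using dims by (simp add: scalar_prod_add_distrib[where n = k] mult_mat_vec_carrier)
  ultimately show ?thesis
    using input state by linarith
qed

definition minorizes_lp2 :: "problem \<Rightarrow> real vec \<Rightarrow> real \<Rightarrow> bool" where
  "minorizes_lp2 P a b \<longleftrightarrow>
     (\<forall>y x u. lp2_feasible P y x u \<longrightarrow> a \<bullet> y + b \<le> lp2_objective P x u)"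

text \<open>
  The multipliers belong to the trajectory \<open>(x', u')\<close>, but the bound holds along every feasible
  trajectory: the stage bounds use the dual constraints only, and they telescope once the
  multiplier of each dynamics constraint is read as the price of the successor state.
\<close>

lemma dual_variables_give_lower_bound:
  assumes wf: "well_formed P" and dual: "lp2_dual P x' u' lam \<nu>"
  shows "minorizes_lp2 P (cut_slope P lam \<nu>) (cut_offset P \<nu>)"
  unfolding minorizes_lp2_def
proof (intro allI impI)
  fix y x u
  assume feas: "lp2_feasible P y x u"
  let ?S = "tsplit P" and ?T = "horizon P"
  have ST: "?S < ?T"
    using wf by (simp add: well_formed_def)
  define price where "price t = (if t < ?T
      then cvec P t + transpose_mat (Amat P t) *\<^sub>v lam t + transpose_mat (Emat P t) *\<^sub>v \<nu> t
      else cvec P ?T)" for t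
  have stage: "price t \<bullet> x t - price (Suc t) \<bullet> x (Suc t) - \<nu> t \<bullet> hvec P t
      \<le> cvec P t \<bullet> x t + dvec P t \<bullet> u t" if t: "t \<in> {?S..<?T}" for t
  proof -
    have mult: "lam t \<in> carrier_vec (xdim P (Suc t))" "\<nu> t \<in> carrier_vec (hdim P t)"
      and nonneg: "0\<^sub>v (hdim P t) \<le> \<nu> t"
      and stationary: "dvec P t + transpose_mat (Bmat P t) *\<^sub>v lam t
          + transpose_mat (Fmat P t) *\<^sub>v \<nu> t = 0\<^sub>v (udim P t)"
      and lam: "lam t = price (Suc t)"
      using dual t unfolding lp2_dual_def price_def by blast+
    have dims: "cvec P t \<in> carrier_vec (xdim P t)" "dvec P t \<in> carrier_vec (udim P t)"
        "Amat P t \<in> carrier_mat (xdim P (Suc t)) (xdim P t)"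
        "Bmat P t \<in> carrier_mat (xdim P (Suc t)) (udim P t)"
        "Emat P t \<in> carrier_mat (hdim P t) (xdim P t)"
        "Fmat P t \<in> carrier_mat (hdim P t) (udim P t)"
        "hvec P t \<in> carrier_vec (hdim P t)"
      using wf t by (simp_all add: well_formed_def)
    have dynamics: "x (Suc t) = Amat P t *\<^sub>v x t + Bmat P t *\<^sub>v u t"
      and xu: "x t \<in> carrier_vec (xdim P t)" "u t \<in> carrier_vec (udim P t)"
      and constr: "Emat P t *\<^sub>v x t + Fmat P t *\<^sub>v u t \<le> hvec P t"
      using feas t by (auto simp: lp2_feasible_def Ztilde_def)
    have "price t \<bullet> x t - \<nu> t \<bullet> hvec P t
        \<le> cvec P t \<bullet> x t + dvec P t \<bullet> u t + lam t \<bullet> x (Suc t)"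
      using stage_lagrangian_bound[OF dims(3-6) xu dims(1,2,7) mult stationary nonneg constr] t
      by (simp add: price_def dynamics)
    then show ?thesis
      by (simp add: lam)
  qed
  have "(\<Sum>t = ?S..<?T. price (Suc t) \<bullet> x (Suc t) - price t \<bullet> x t)
      = price ?T \<bullet> x ?T - price ?S \<bullet> x ?S"
    by (rule sum_Suc_diff'[where f = "\<lambda>t. price t \<bullet> x t"]) (use ST in simp)
  moreover have "(\<Sum>t = ?S..<?T. price t \<bullet> x t - price (Suc t) \<bullet> x (Suc t) - \<nu> t \<bullet> hvec P t)
      \<le> (\<Sum>t = ?S..<?T. cvec P t \<bullet> x t + dvec P t \<bullet> u t)"
    by (rule sum_mono) (rule stage)
  ultimately have "price ?S \<bullet> x ?S - (\<Sum>t = ?S..<?T. \<nu> t \<bullet> hvec P t) \<le> lp2_objective P x u"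
    by (simp add: lp2_objective_def price_def[of ?T] sum_subtractf)
  moreover have "x ?S = y"
    using feas by (simp add: lp2_feasible_def)
  moreover have "cut_slope P lam \<nu> = price ?S"
  proof -
    have "cvec P ?S \<in> carrier_vec (xdim P ?S)" "Amat P ?S \<in> carrier_mat (xdim P (Suc ?S)) (xdim P ?S)"
        "Emat P ?S \<in> carrier_mat (hdim P ?S) (xdim P ?S)"
      using wf ST by (simp_all add: well_formed_def)
    moreover have "lam ?S \<in> carrier_vec (xdim P (Suc ?S))" "\<nu> ?S \<in> carrier_vec (hdim P ?S)"
      using dual ST unfolding lp2_dual_def by (meson atLeastLessThan_iff order_refl)+
    ultimately have "transpose_mat (Amat P ?S) *\<^sub>v lam ?S \<in> carrier_vec (xdim P ?S)"
        "transpose_mat (Emat P ?S) *\<^sub>v \<nu> ?S \<in> carrier_vec (xdim P ?S)"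
        "cvec P ?S \<in> carrier_vec (xdim P ?S)"
      by (auto intro!: mult_mat_vec_carrier)
    then show ?thesis
      using ST by (simp add: cut_slope_def price_def comm_add_vec[of _ "xdim P ?S" "cvec P ?S"]
          assoc_add_vec[of "cvec P ?S" "xdim P ?S"])
  qed
  moreover have "cut_offset P \<nu> = - (\<Sum>t = ?S..<?T. \<nu> t \<bullet> hvec P t)"
  proof -
    have "{?S..<?T} = insert ?S {?S<..<?T}"
      using ST by auto
    then show ?thesis
      by (simp add: cut_offset_def)
  qed
  ultimately show "cut_slope P lam \<nu> \<bullet> y + cut_offset P \<nu> \<le> lp2_objective P x u"
    by simp
qed

section \<open>Invariants of the algorithm\<close>

lemma ddp_cuts_minorize:
  assumes "ddp P \<epsilon> H UB LB x u" and "well_formed P"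
  shows "finite H \<and> (\<forall>(a, b) \<in> H. minorizes_lp2 P a b)"
  using assms by induction (auto intro: dual_variables_give_lower_bound)

lemma cut_max_le_lp2_objective:
  assumes "finite H" "H \<noteq> {}" "\<forall>(a, b) \<in> H. minorizes_lp2 P a b" "lp2_feasible P y x u"
  shows "cut_max H y \<le> lp2_objective P x u"
  using assms unfolding cut_max_def by (subst Max_le_iff) (auto simp: minorizes_lp2_def)

text \<open>
  A successful stopping test equates \<open>LB\<close> with a real number, so it cannot happen before the
  first iteration is complete; hence the current solution and \<open>LB\<close> both stem from the
  first-stage problem with the present cuts.
\<close>

lemma ddp_bounded_below_eps_optimal:
  assumes "ddp P \<epsilon> H UB LB x u" and "LB \<noteq> -\<infinity>"
  shows "H \<noteq> {} \<and> nlp1_eps_optimal P \<epsilon> (cut_max H) x u \<and> LB = ereal (cut_max H (x (tsplit P)))"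
  using assms by cases auto

lemma ddp_converges_obtains_cuts:
  assumes conv: "ddp_converges P \<epsilon> x u" and wf: "well_formed P"
  obtains H x' u' where
    "\<And>y z w. lp2_feasible P y z w \<Longrightarrow> cut_max H y \<le> lp2_objective P z w"
    "nlp1_eps_optimal P \<epsilon> (cut_max H) x u"
    "lp2_feasible P (x (tsplit P)) x' u'"
    "lp2_objective P x' u' = cut_max H (x (tsplit P))"
proof -
  obtain H UB LB x' u' where run: "ddp P \<epsilon> H UB LB x u"
    and opt: "lp2_optimal P (x (tsplit P)) x' u'" and stop: "ereal (lp2_objective P x' u') = LB"
    using conv unfolding ddp_converges_def by blast
  have iter: "H \<noteq> {}" "nlp1_eps_optimal P \<epsilon> (cut_max H) x u"
      "LB = ereal (cut_max H (x (tsplit P)))"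
    using ddp_bounded_below_eps_optimal[OF run] stop by auto
  have "cut_max H y \<le> lp2_objective P z w" if "lp2_feasible P y z w" for y z w
    using cut_max_le_lp2_objective[OF _ iter(1) _ that] ddp_cuts_minorize[OF run wf] by simp
  moreover have "lp2_feasible P (x (tsplit P)) x' u'"
    using opt by (simp add: lp2_optimal_def)
  moreover have "lp2_objective P x' u' = cut_max H (x (tsplit P))"
    using stop iter(3) by simp
  ultimately show thesis
    using that iter(2) by blast
qed

section \<open>Transfer between the linear and the exact tail\<close>

definition tail_cost :: "problem \<Rightarrow> (nat \<Rightarrow> real vec) \<Rightarrow> (nat \<Rightarrow> real vec) \<Rightarrow> real" where
  "tail_cost P x u =
     (\<Sum>t = tsplit P..<horizon P. cost P t (x t) (u t)) + fcost P (x (horizon P))"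

lemma matched_cost_bounds:
  assumes B: "assumption_B P M \<delta>" and feas: "lp2_feasible P y x' u'"
    and match: "matched P M x' u' x u"
  shows "lp2_objective P x' u' \<le> tail_cost P x u"
    and "tail_cost P x u \<le> lp2_objective P x' u' + (\<Sum>t = tsplit P..<horizon P. \<delta> t)"
proof -
  have stage: "cvec P t \<bullet> x' t + dvec P t \<bullet> u' t \<le> cost P t (x t) (u t)"
      "cost P t (x t) (u t) \<le> cvec P t \<bullet> x' t + dvec P t \<bullet> u' t + \<delta> t"
    if t: "t \<in> {tsplit P..<horizon P}" for t
  proof -
    have "(x' t, u' t) \<in> Ztilde P t" "M t (x' t, u' t) = (x t, u t)"
      using feas match t by (auto simp: lp2_feasible_def matched_def)
    moreover have "\<forall>(x, u) \<in> Ztilde P t.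
        cvec P t \<bullet> x + dvec P t \<bullet> u \<le> case_prod (cost P t) (M t (x, u)) \<and>
        case_prod (cost P t) (M t (x, u)) \<le> cvec P t \<bullet> x + dvec P t \<bullet> u + \<delta> t"
      using B t unfolding assumption_B_def by blast
    ultimately show "cvec P t \<bullet> x' t + dvec P t \<bullet> u' t \<le> cost P t (x t) (u t)"
        "cost P t (x t) (u t) \<le> cvec P t \<bullet> x' t + dvec P t \<bullet> u' t + \<delta> t"
      by force+
  qed
  have final: "fcost P (x (horizon P)) = cvec P (horizon P) \<bullet> x' (horizon P)"
    using match by (simp add: matched_def)
  have "(\<Sum>t = tsplit P..<horizon P. cvec P t \<bullet> x' t + dvec P t \<bullet> u' t)
      \<le> (\<Sum>t = tsplit P..<horizon P. cost P t (x t) (u t))"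
    by (rule sum_mono) (rule stage(1))
  then show "lp2_objective P x' u' \<le> tail_cost P x u"
    using final by (simp add: lp2_objective_def tail_cost_def)
  have "(\<Sum>t = tsplit P..<horizon P. cost P t (x t) (u t))
      \<le> (\<Sum>t = tsplit P..<horizon P. cvec P t \<bullet> x' t + dvec P t \<bullet> u' t + \<delta> t)"
    by (rule sum_mono) (rule stage(2))
  then show "tail_cost P x u \<le> lp2_objective P x' u' + (\<Sum>t = tsplit P..<horizon P. \<delta> t)"
    using final by (simp add: lp2_objective_def tail_cost_def sum.distrib)
qed

section \<open>Splitting the exact problem at the intermediate stage\<close>

lemma sum_cost_split:
  assumes "tsplit P < horizon P"
  shows "(\<Sum>t<horizon P. cost P t (x t) (u t)) + fcost P (x (horizon P))
           = first_cost P x u + tail_cost P x u"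
  using sum.atLeastLessThan_concat[of 0 "tsplit P" "horizon P" "\<lambda>t. cost P t (x t) (u t)"] assms
  by (simp add: first_cost_def tail_cost_def atLeast0LessThan)

lemma nlp_feasible_split:
  assumes "tsplit P < horizon P" "nlp_feasible P x u"
  shows "nlp1_feasible P x u" and "tail_feasible P (x (tsplit P)) x u"
  using assms by (auto simp: nlp_feasible_def nlp1_feasible_def tail_feasible_def follows_def)

text \<open>
  A first stage followed by an exact tail is feasible for the exact problem, with the sum of the
  two costs.
\<close>

lemma G0_le_first_cost_plus_Gtail:
  assumes ST: "tsplit P < horizon P" and first: "nlp1_feasible P x u"
  shows "G0 P \<le> ereal (first_cost P x u) + Gtail P (x (tsplit P))"
proof -
  have "G0 P - ereal (first_cost P x u) \<le> ereal (tail_cost P z w)"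
    if tail: "tail_feasible P (x (tsplit P)) z w" for z w
  proof -
    \<comment> \<open>The two state trajectories agree at the joint, so the state there may come from either;
      the input there must come from the tail.\<close>
    define X where "X t = (if t \<le> tsplit P then x t else z t)" for t
    define U where "U t = (if t < tsplit P then u t else w t)" for t
    have zx: "z (tsplit P) = x (tsplit P)"
      using tail by (simp add: tail_feasible_def)
    then have X_tail: "X t = z t" if "tsplit P \<le> t" for t
      using that by (auto simp: X_def)
    have feas: "nlp_feasible P X U"
      unfolding nlp_feasible_def follows_def
    proof (intro conjI ballI)
      show "X 0 = xinit P"
        using first by (simp add: X_def nlp1_feasible_def)
    next
      fix t assume t: "t \<in> {..<horizon P}"
      show "X (Suc t) = dyn P t (X t) (U t)" "(X t, U t) \<in> Zset P t"
      proof -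
        consider "t < tsplit P" | "tsplit P \<le> t" by linarith
        then have "X (Suc t) = dyn P t (X t) (U t) \<and> (X t, U t) \<in> Zset P t"
        proof cases
          case 1
          then show ?thesis
            using first by (simp add: X_def U_def nlp1_feasible_def follows_def)
        next
          case 2
          then show ?thesis
            using tail t by (simp add: X_tail U_def tail_feasible_def follows_def)
        qed
        then show "X (Suc t) = dyn P t (X t) (U t)" "(X t, U t) \<in> Zset P t"
          by blast+
      qed
    qed
    have "first_cost P X U = first_cost P x u"
      unfolding first_cost_def by (rule sum.cong) (auto simp: X_def U_def)
    moreover have "tail_cost P X U = tail_cost P z w"
      using ST by (simp add: tail_cost_def X_tail U_def)
    ultimately have "G0 P \<le> ereal (first_cost P x u + tail_cost P z w)"
      unfolding G0_def using feas sum_cost_split[OF ST, of X U]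
      by (intro INF_lower2[where i = "(X, U)"]) auto
    then show ?thesis
      by (simp add: ereal_minus_le add.commute)
  qed
  then have "G0 P - ereal (first_cost P x u) \<le> Gtail P (x (tsplit P))"
    unfolding Gtail_def by (intro INF_greatest) (auto simp: tail_cost_def)
  then show ?thesis
    by (simp add: ereal_minus_le add.commute)
qed

section \<open>The error bound\<close>

theorem theorem3:
  fixes P :: problem
    and M :: "nat \<Rightarrow> real vec \<times> real vec \<Rightarrow> real vec \<times> real vec"
    and \<delta> :: "nat \<Rightarrow> real" and \<epsilon> :: real
    and x u :: "nat \<Rightarrow> real vec"
  assumes "well_formed P"
    and "\<exists>x u. nlp_feasible P x u"
    and "\<exists>x u x' u'. nlp1_feasible P x u \<and> lp2_feasible P (x (tsplit P)) x' u'"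
    and "assumption_A P"
    and "assumption_B P M \<delta>"
    and "dynamics_compatible P M"
    and "0 \<le> \<epsilon>"
    and "ddp_converges P \<epsilon> x u"
  shows "G0 P \<le> ereal (\<Sum>t<tsplit P. cost P t (x t) (u t)) + Gtail P (x (tsplit P)) \<and>
         ereal (\<Sum>t<tsplit P. cost P t (x t) (u t)) + Gtail P (x (tsplit P))
           \<le> G0 P + ereal \<epsilon> + ereal (\<Sum>t = tsplit P..<horizon P. \<delta> t)"
proof -
  have ST: "tsplit P < horizon P"
    using assms(1) by (simp add: well_formed_def)
  obtain H x' u' where cuts: "\<And>y z w. lp2_feasible P y z w \<Longrightarrow> cut_max H y \<le> lp2_objective P z w"
    and opt: "nlp1_eps_optimal P \<epsilon> (cut_max H) x u"
    and lin: "lp2_feasible P (x (tsplit P)) x' u'"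
    and tight: "lp2_objective P x' u' = cut_max H (x (tsplit P))"
    using ddp_converges_obtains_cuts[OF assms(8,1)] by blast
  have first: "nlp1_feasible P x u"
    using opt by (simp add: nlp1_eps_optimal_def)
  let ?C = "first_cost P x u" and ?V = "cut_max H (x (tsplit P))"
    and ?D = "\<Sum>t = tsplit P..<horizon P. \<delta> t"
  have upper: "Gtail P (x (tsplit P)) \<le> ereal (?V + ?D)"
  proof -
    have "x (tsplit P) \<in> nlp1_states P"
      using first by (auto simp: nlp1_states_def)
    then obtain z w where tail: "tail_feasible P (x (tsplit P)) z w" and "matched P M x' u' z w"
      using assms(6) lin unfolding dynamics_compatible_def by blast
    then have "tail_cost P z w \<le> ?V + ?D"
      using matched_cost_bounds(2)[OF assms(5) lin] tight by simp
    then show ?thesis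
      unfolding Gtail_def using tail
      by (intro INF_lower2[where i = "(z, w)"]) (auto simp: tail_cost_def)
  qed
  have lower: "ereal (?C + ?V - \<epsilon>) \<le> G0 P"
    unfolding G0_def
  proof (rule INF_greatest, clarsimp)
    fix z w assume feas: "nlp_feasible P z w"
    note split = nlp_feasible_split[OF ST feas]
    have "z (tsplit P) \<in> nlp1_states P"
      using split(1) by (auto simp: nlp1_states_def)
    then obtain z' w' where lin': "lp2_feasible P (z (tsplit P)) z' w'"
      and match: "matched P M z' w' z w"
      using assms(6) split(2) unfolding dynamics_compatible_def by blast
    have "nlp1_value P (cut_max H) \<le> ereal (first_cost P z w + cut_max H (z (tsplit P)))"
      unfolding nlp1_value_def using split(1) by (intro INF_lower2[where i = "(z, w)"]) auto
    then have "nlp1_value P (cut_max H) + ereal \<epsilon>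
        \<le> ereal (first_cost P z w + cut_max H (z (tsplit P))) + ereal \<epsilon>"
      by (rule add_right_mono)
    with opt have "ereal (?C + ?V) \<le> ereal (first_cost P z w + cut_max H (z (tsplit P))) + ereal \<epsilon>"
      unfolding nlp1_eps_optimal_def by (meson order_trans)
    then have "?C + ?V - \<epsilon> \<le> first_cost P z w + cut_max H (z (tsplit P))"
      by simp
    also have "\<dots> \<le> first_cost P z w + tail_cost P z w"
      using cuts[OF lin'] matched_cost_bounds(1)[OF assms(5) lin' match] by simp
    finally show "?C + ?V - \<epsilon>
        \<le> (\<Sum>t<horizon P. cost P t (z t) (w t)) + fcost P (z (horizon P))"
      by (simp add: sum_cost_split[OF ST])
  qed
  have "ereal ?C + Gtail P (x (tsplit P)) \<le> ereal ?C + ereal (?V + ?D)"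
    using upper by (rule add_left_mono)
  also have "\<dots> = ereal (?C + ?V - \<epsilon>) + ereal \<epsilon> + ereal ?D"
    by simp
  also have "\<dots> \<le> G0 P + ereal \<epsilon> + ereal ?D"
    by (intro add_right_mono lower)
  finally show ?thesis
    using G0_le_first_cost_plus_Gtail[OF ST first] by (simp add: first_cost_def)
qed

end
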